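(* Let $A$ be a finite alphabet. The coloured non-commutative elementary symmetric functions $(E_I)$, indexed by sentences $I$ over $A$, form a linear basis of $\mathrm{NSym}_A$; in particular, for every sentence $I$, $$H_I=\sum_{J\preccurlyeq I}(-1)^{|I|-\ell(J)}E_J .$$
   Context: $\Bbbk$ is a field of characteristic zero. A sentence $I=(w_1,\dots,w_m)$ over $A$ is a finite sequence of non-empty words in letters of $A$; $1$ is the empty sentence. $\ell(I)=m$ is its length and $|I|=|w_1|+\dots+|w_m|$ its size (total number of letters). Write $J\preccurlyeq I$ ($J$ refines $I$) if the words of $I$ can be obtained by concatenating adjacent words of $J$. $\mathrm{NSym}_A$ is the $\Bbbk$-algebra with linear basis $(H_I)$ indexed by sentences over $A$, with product $H_I\cdot H_J=H_{I\cdot J}$, where $I\cdot J$ is concatenation of sequences of words. The coloured non-commutative elementary symmetric functions are $$E_I=\sum_{J\preccurlyeq I}(-1)^{|I|-\ell(J)}H_J .$$ *)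

theory Defs
  imports Complex_Main "HOL-Library.Poly_Mapping"
begin

section \<open>Sentences\<close>

typedef 'a sentence = "{ws :: 'a list list. [] \<notin> set ws}"
  morphisms words_of Sentence
  by (rule exI[of _ "[]"]) simp

setup_lifting type_definition_sentence

text \<open>Concatenation of sequences of words is written additively, so that the convolution product
  of \<^theory>\<open>HOL-Library.Poly_Mapping\<close> becomes the product of the algebra; the empty
  sentence is \<open>0\<close> as a sentence, and its basis element is the unit of the algebra.\<close>

instantiation sentence :: (type) monoid_add
begin

lift_definition zero_sentence :: "'a sentence" is "[]" by simp

lift_definition plus_sentence :: "'a sentence \<Rightarrow> 'a sentence \<Rightarrow> 'a sentence" is "(@)" by simp

instance by standard (transfer; simp)+

end

definition letters :: "'a sentence \<Rightarrow> 'a set" where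
  "letters I = set (concat (words_of I))"

definition sentences :: "'a set \<Rightarrow> 'a sentence set" where
  "sentences A = {I. letters I \<subseteq> A}"

definition sent_length :: "'a sentence \<Rightarrow> nat" where
  "sent_length I = length (words_of I)"

definition sent_size :: "'a sentence \<Rightarrow> nat" where
  "sent_size I = sum_list (map length (words_of I))"

text \<open>\<open>J\<close> is cut into consecutive blocks \<open>K\<close>, and the words of \<open>I\<close> are the
  concatenations of the blocks. No block is empty, since the words of \<open>I\<close> are not.\<close>

definition refines :: "'a sentence \<Rightarrow> 'a sentence \<Rightarrow> bool"  (infix "\<preceq>\<^sub>r" 50) where
  "J \<preceq>\<^sub>r I \<longleftrightarrow> (\<exists>K. concat K = words_of J \<and> map concat K = words_of I)"

lemma nonempty_words: "[] \<notin> set (words_of I)"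
  using words_of[of I] by simp

lemma refines_concat: "J \<preceq>\<^sub>r I \<Longrightarrow> concat (words_of J) = concat (words_of I)"
proof -
  have "concat (concat K) = concat (map concat K)" for K :: "'a list list list"
    by (induction K) auto
  then show "J \<preceq>\<^sub>r I \<Longrightarrow> ?thesis"
    unfolding refines_def by metis
qed

lemma refines_letters: "J \<preceq>\<^sub>r I \<Longrightarrow> letters J = letters I"
  by (simp add: letters_def refines_concat)

lemma length_le_size: "sent_length J \<le> sent_size J"
proof -
  have "[] \<notin> set ws \<Longrightarrow> length ws \<le> sum_list (map length ws)" for ws :: "'a list list"
  proof (induction ws)
    case (Cons w ws)
    then show ?case by (cases w) auto
  qed simp
  then show ?thesis
    using nonempty_words by (auto simp: sent_length_def sent_size_def)
qed

lemma refines_size: "J \<preceq>\<^sub>r I \<Longrightarrow> sent_size J = sent_size I"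
  using refines_concat[of J I] by (metis sent_size_def length_concat)

lemma refines_length_le: "J \<preceq>\<^sub>r I \<Longrightarrow> sent_length J \<le> sent_size I"
  using length_le_size refines_size by metis

lemma finite_refinements: "finite {J. J \<preceq>\<^sub>r I}"
proof -
  let ?W = "{w. set w \<subseteq> letters I \<and> length w \<le> sent_size I}"
  let ?S = "{ws. set ws \<subseteq> ?W \<and> length ws \<le> sent_size I}"
  have fin: "finite ?S"
    by (intro finite_lists_length_le) (simp add: letters_def)
  have "words_of ` {J. J \<preceq>\<^sub>r I} \<subseteq> ?S"
  proof (rule image_subsetI, clarify, intro conjI subsetI CollectI)
    fix J assume J: "J \<preceq>\<^sub>r I"
    show "length (words_of J) \<le> sent_size I"
      using refines_length_le[OF J] by (simp add: sent_length_def)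
    fix w assume w: "w \<in> set (words_of J)"
    then show "x \<in> letters I" if "x \<in> set w" for x
      using refines_letters[OF J] that by (auto simp: letters_def)
    show "length w \<le> sent_size I"
      using w member_le_sum_list[of "length w" "map length (words_of J)"] refines_size[OF J]
      by (simp add: sent_size_def)
  qed
  then show ?thesis
    using fin by (meson finite_imageD finite_subset inj_on_def words_of_inject)
qed


section \<open>The algebra of coloured non-commutative symmetric functions\<close>

definition nsym_scale :: "'k::field \<Rightarrow> ('a sentence \<Rightarrow>\<^sub>0 'k) \<Rightarrow> ('a sentence \<Rightarrow>\<^sub>0 'k)" where
  "nsym_scale c = Poly_Mapping.map ((*) c)"

lemma lookup_nsym_scale [simp]: "Poly_Mapping.lookup (nsym_scale c f) I = c * Poly_Mapping.lookup f I"
  by (simp add: nsym_scale_def Poly_Mapping.map.rep_eq when_def)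

interpretation nsym: vector_space "nsym_scale :: 'k::field \<Rightarrow> ('a sentence \<Rightarrow>\<^sub>0 'k) \<Rightarrow> _"
  by standard (auto intro!: poly_mapping_eqI simp: lookup_add algebra_simps)

text \<open>The letters of the alphabet form a set \<open>A\<close>; the algebra over \<open>A\<close> consists of
  the finitely supported functions on sentences that vanish outside the sentences over \<open>A\<close>.\<close>

definition NSym :: "'a set \<Rightarrow> ('a sentence \<Rightarrow>\<^sub>0 'k::field) set" where
  "NSym A = {f. Poly_Mapping.keys f \<subseteq> sentences A}"

definition H :: "'a sentence \<Rightarrow> ('a sentence \<Rightarrow>\<^sub>0 'k::field)" where
  "H I = Poly_Mapping.single I 1"

text \<open>The subtraction in the exponent does not truncate, by \<open>refines_length_le\<close>.\<close>

definition E :: "'a sentence \<Rightarrow> ('a sentence \<Rightarrow>\<^sub>0 'k::field)" where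
  "E I = (\<Sum>J | J \<preceq>\<^sub>r I. nsym_scale ((-1) ^ (sent_size I - sent_length J)) (H J))"

definition is_basis_family :: "'i set \<Rightarrow> ('i \<Rightarrow> ('a sentence \<Rightarrow>\<^sub>0 'k::field)) \<Rightarrow>
    ('a sentence \<Rightarrow>\<^sub>0 'k) set \<Rightarrow> bool" where
  "is_basis_family S b V \<longleftrightarrow>
     inj_on b S \<and> nsym.independent (b ` S) \<and> nsym.span (b ` S) = V"

lemma H_mult: "H I * H J = (H (I + J) :: 'a sentence \<Rightarrow>\<^sub>0 'k::field)"
  by (simp add: H_def mult_single)

lemma H_zero: "H 0 = (1 :: 'a sentence \<Rightarrow>\<^sub>0 'k::field)"
  by (simp add: H_def)

lemma nsym_subspace: "nsym.subspace (NSym A)"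
proof (rule nsym.subspaceI)
  show "0 \<in> NSym A" by (simp add: NSym_def)
  show "f + g \<in> NSym A" if "f \<in> NSym A" "g \<in> NSym A" for f g
    using that keys_add[of f g] by (auto simp: NSym_def)
  show "nsym_scale c f \<in> NSym A" if "f \<in> NSym A" for c f
    using that by (auto simp: NSym_def in_keys_iff)
qed

lemma NSym_mult_closed:
  assumes "f \<in> NSym A" "g \<in> NSym A"
  shows "f * g \<in> NSym A"
proof -
  have "I + J \<in> sentences A" if "I \<in> sentences A" "J \<in> sentences A" for I J
    using that by (auto simp: sentences_def letters_def plus_sentence.rep_eq)
  then show ?thesis
    using assms keys_mult[of f g] by (fastforce simp: NSym_def)
qed

lemma
  fixes c :: "'k::field" and f g :: "'a sentence \<Rightarrow>\<^sub>0 'k"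
  shows nsym_scale_mult_left: "nsym_scale c f * g = nsym_scale c (f * g)"
    and nsym_scale_mult_right: "f * nsym_scale c g = nsym_scale c (f * g)"
proof -
  have scale_single: "nsym_scale c (Poly_Mapping.single I a) = Poly_Mapping.single I (c * a)"
    for c a :: 'k and I :: "'a sentence"
    by (rule poly_mapping_eqI) (simp add: lookup_single when_def)
  have monomials: "f = (\<Sum>I\<in>Poly_Mapping.keys f. Poly_Mapping.single I (Poly_Mapping.lookup f I))"
    for f :: "'a sentence \<Rightarrow>\<^sub>0 'k"
    by (rule poly_mapping_eqI) (simp add: lookup_sum lookup_single when_def in_keys_iff)
  have zero: "nsym_scale c f = Poly_Mapping.single 0 c * f"
    and zero': "nsym_scale c f = f * Poly_Mapping.single 0 c"
    for c :: 'k and f :: "'a sentence \<Rightarrow>\<^sub>0 'k"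
    by (subst (1 2) monomials[of f],
        simp add: nsym.scale_sum_right sum_distrib_left sum_distrib_right
          scale_single mult_single mult.commute)+
  show "nsym_scale c f * g = nsym_scale c (f * g)"
    by (simp add: zero mult.assoc)
  show "f * nsym_scale c g = nsym_scale c (f * g)"
    by (simp add: zero' mult.assoc)
qed

lemma H_basis: "is_basis_family (sentences A) H (NSym A :: ('a sentence \<Rightarrow>\<^sub>0 'k::field) set)"
  unfolding is_basis_family_def
proof (intro conjI)
  let ?H = "H :: 'a sentence \<Rightarrow> 'a sentence \<Rightarrow>\<^sub>0 'k"
  have look: "Poly_Mapping.lookup (?H I) J = (if I = J then 1 else 0)" for I J
    by (simp add: H_def lookup_single when_def)
  have inj: "inj ?H"
    by (rule injI) (metis look zero_neq_one)
  then show "inj_on ?H (sentences A)"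
    by (rule inj_on_subset) simp
  have expand: "Poly_Mapping.lookup (\<Sum>J\<in>S. nsym_scale (u J) (?H J)) I = (if I \<in> S then u I else 0)"
    if "finite S" for S u I
    using that by (simp add: lookup_sum look if_distrib cong: if_cong)
  show "nsym.independent (?H ` sentences A)"
  proof
    assume "nsym.dependent (?H ` sentences A)"
    then obtain T u v where T: "finite T" "T \<subseteq> ?H ` sentences A" "v \<in> T" "u v \<noteq> 0"
      and sum0: "(\<Sum>v\<in>T. nsym_scale (u v) v) = 0"
      unfolding nsym.dependent_explicit by blast
    then obtain S where S: "finite S" "T = ?H ` S"
      by (meson finite_subset_image)
    then obtain I where I: "I \<in> S" "v = ?H I"
      using T by blast
    have "(\<Sum>J\<in>S. nsym_scale (u (?H J)) (?H J)) = 0"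
      using sum0 S by (simp add: sum.reindex inj_on_subset[OF inj])
    then have "u (?H I) = 0"
      using expand[OF S(1), of "\<lambda>J. u (?H J)" I] I by simp
    then show False
      using T I by simp
  qed
  show "nsym.span (?H ` sentences A) = NSym A"
  proof
    show "nsym.span (?H ` sentences A) \<subseteq> NSym A"
      by (rule nsym.span_minimal[OF _ nsym_subspace]) (auto simp: NSym_def H_def)
    show "NSym A \<subseteq> nsym.span (?H ` sentences A)"
    proof
      fix f :: "'a sentence \<Rightarrow>\<^sub>0 'k" assume f: "f \<in> NSym A"
      have "f = (\<Sum>J\<in>Poly_Mapping.keys f. nsym_scale (Poly_Mapping.lookup f J) (?H J))"
        by (rule poly_mapping_eqI) (simp add: expand in_keys_iff)
      also have "\<dots> \<in> nsym.span (?H ` sentences A)"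
        using f by (intro nsym.span_sum nsym.span_scale nsym.span_base) (auto simp: NSym_def)
      finally show "f \<in> nsym.span (?H ` sentences A)" .
    qed
  qed
qed

end

theory Submission
  imports Defs
begin

text \<open>Substituting the definition of \<open>E\<close> into the claimed formula for \<open>H\<close>, the coefficient of
  \<open>H K\<close> becomes, up to sign, the sum of \<open>(-1) ^ \<ell>(J)\<close> over the refinement interval between \<open>K\<close>
  and \<open>I\<close>. This sum vanishes unless \<open>K = I\<close>: as soon as a word of \<open>I\<close> properly extends the
  corresponding first word \<open>k\<close> of \<open>K\<close>, the intermediate sentences cancel in pairs, one having \<open>k\<close>
  as a word of its own and the other having \<open>k\<close> merged with its successor. Hence the linear map
  sending \<open>H I\<close> to \<open>E I\<close> is an involution, so it carries the basis \<open>H\<close> to a basis.\<close>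

section \<open>Coarsenings of a list of words\<close>

fun merge_hd :: "'a list \<Rightarrow> 'a list list \<Rightarrow> 'a list list" where
  "merge_hd k [] = [k]"
| "merge_hd k (w # ws) = (k @ w) # ws"

text \<open>Recursion on the finer list replaces the existential over blocks in
  \<open>refines\<close> and makes induction available: the first word stays on its own or is glued
  to the first word of a coarsening of the rest. The second option removes \<open>[]\<close>, as
  gluing needs a successor.\<close>

primrec coarsenings :: "'a list list \<Rightarrow> 'a list list set" where
  "coarsenings [] = {[]}"
| "coarsenings (k # ws) =
     Cons k ` coarsenings ws \<union> merge_hd k ` (coarsenings ws - {[]})"

lemma finite_coarsenings [simp]: "finite (coarsenings ws)"
  by (induction ws) auto

lemma merge_hd_image_iff:
  "vs \<in> merge_hd k ` (C - {[]}) \<longleftrightarrow> (\<exists>u us. u # us \<in> C \<and> vs = (k @ u) # us)"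
proof
  assume "vs \<in> merge_hd k ` (C - {[]})"
  then obtain us where "us \<in> C" "us \<noteq> []" "vs = merge_hd k us" by auto
  then show "\<exists>u us. u # us \<in> C \<and> vs = (k @ u) # us" by (cases us) auto
next
  assume "\<exists>u us. u # us \<in> C \<and> vs = (k @ u) # us"
  then obtain u us where "u # us \<in> C - {[]}" "vs = merge_hd k (u # us)" by auto
  then show "vs \<in> merge_hd k ` (C - {[]})" by blast
qed

lemma coarsenings_Cons_iff:
  "vs \<in> coarsenings (k # ws) \<longleftrightarrow> (\<exists>us \<in> coarsenings ws. vs = k # us) \<or>
    (\<exists>u us. u # us \<in> coarsenings ws \<and> vs = (k @ u) # us)"
  by (auto simp: merge_hd_image_iff)

declare coarsenings.simps(2) [simp del]

lemma coarsenings_nonempty_words: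
  "[] \<notin> set ws \<Longrightarrow> vs \<in> coarsenings ws \<Longrightarrow> [] \<notin> set vs"
proof (induction ws arbitrary: vs)
  case (Cons k ws)
  then show ?case
    by (fastforce simp: coarsenings_Cons_iff)
qed simp

text \<open>If the first block is \<open>k # b\<close>, an empty \<open>b\<close> means that
  \<open>k\<close> stays a word of its own, and a nonempty \<open>b\<close> means that
  \<open>k\<close> is merged into what \<open>b\<close> and the later blocks yield.\<close>

lemma coarsenings_iff_blocks:
  assumes "[] \<notin> set ws" "[] \<notin> set vs"
  shows "vs \<in> coarsenings ws \<longleftrightarrow> (\<exists>K. concat K = ws \<and> map concat K = vs)"
  using assms
proof (induction ws arbitrary: vs)
  case Nil
  show ?case
  proof
    assume "\<exists>K. concat K = [] \<and> map concat K = vs"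
    then obtain K where K: "concat K = []" "map concat K = vs" by blast
    then have "K = []" using Nil by (cases K) auto
    then show "vs \<in> coarsenings []" using K by simp
  qed (auto intro: exI[of _ "[]"])
next
  case (Cons k ws)
  have ne: "k \<noteq> []" "[] \<notin> set ws" using Cons.prems by auto
  note IH = Cons.IH[OF ne(2)]
  show ?case
  proof
    assume "vs \<in> coarsenings (k # ws)"
    then consider us where "us \<in> coarsenings ws" "vs = k # us"
      | u us where "u # us \<in> coarsenings ws" "vs = (k @ u) # us"
      by (auto simp: coarsenings_Cons_iff)
    then show "\<exists>K. concat K = k # ws \<and> map concat K = vs"
    proof cases
      case 1
      then obtain K where "concat K = ws" "map concat K = us"
        using IH[of us] Cons.prems by auto
      then show ?thesis using 1 by (intro exI[of _ "[k] # K"]) simp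
    next
      case 2
      have "\<exists>K. concat K = ws \<and> map concat K = u # us"
        using IH[OF coarsenings_nonempty_words[OF ne(2) 2(1)]] 2(1) by simp
      then obtain K where "concat K = ws" "map concat K = u # us" by (elim exE conjE)
      moreover from this obtain m L where "K = m # L" by (cases K) auto
      ultimately show ?thesis using 2
        by (intro exI[of _ "(k # m) # L"]) simp
    qed
  next
    assume "\<exists>K. concat K = k # ws \<and> map concat K = vs"
    then obtain K where K: "concat K = k # ws" "map concat K = vs" by blast
    then obtain m L where "K = m # L" by (cases K) auto
    \<comment> \<open>An empty first block would produce an empty word in \<open>vs\<close>.\<close>
    moreover from this obtain b where "m = k # b"
      using K Cons.prems(2) by (cases m) auto
    ultimately have bL: "K = (k # b) # L" by simp
    show "vs \<in> coarsenings (k # ws)"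
    proof (cases "b = []")
      case True
      then have "map concat L \<in> coarsenings ws"
        using K bL IH[of "map concat L"] Cons.prems by auto
      then show ?thesis using K bL True by (auto simp: coarsenings_Cons_iff)
    next
      case False
      then have "concat b \<noteq> []"
        using K bL ne by (cases b) auto
      then have "concat b # map concat L \<in> coarsenings ws"
        using K bL Cons.prems by (subst IH) (auto intro!: exI[of _ "b # L"])
      then show ?thesis using K bL by (auto simp: coarsenings_Cons_iff)
    qed
  qed
qed

text \<open>Merging \<open>k\<close> with a nonempty word makes it strictly longer, so
  \<open>k\<close> can only be the first word of a coarsening if it was left alone. The hypothesis
  on \<open>ws\<close> excludes merging with an empty word.\<close>

lemma Cons_mem_coarsenings_same:
  assumes "[] \<notin> set ws"
  shows "k # us \<in> coarsenings (k # ws) \<longleftrightarrow> us \<in> coarsenings ws"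
  using coarsenings_nonempty_words[OF assms]
  by (fastforce simp: coarsenings_Cons_iff)

lemma Cons_notin_coarsenings_extended:
  assumes "w \<noteq> []"
  shows "k # us \<notin> coarsenings ((k @ w) # ws)"
  using assms by (auto simp: coarsenings_Cons_iff)

lemma append_mem_coarsenings:
  assumes "u \<noteq> []"
  shows "(k @ u) # us \<in> coarsenings (k # ws) \<longleftrightarrow> u # us \<in> coarsenings ws"
  using assms by (auto simp: coarsenings_Cons_iff)

text \<open>Coarsening can only extend the first word on the right, so a common prefix
  cancels.\<close>

lemma append_mem_coarsenings_append:
  "(k @ u) # us \<in> coarsenings ((k @ w) # ws) \<longleftrightarrow> u # us \<in> coarsenings (w # ws)"
  by (auto simp: coarsenings_Cons_iff)

lemma refl_coarsenings: "ws \<in> coarsenings ws"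
  by (induction ws) (auto simp: coarsenings_Cons_iff)

text \<open>The interval is a Boolean lattice: each word boundary of \<open>ws\<close> that is
  absent from \<open>us\<close> may be kept or erased independently. Its alternating sum therefore
  vanishes unless it is a single point. The induction looks at whether the first boundary of
  \<open>ws\<close> survives in \<open>us\<close>.\<close>

theorem alternating_sum_coarsenings:
  assumes "[] \<notin> set ws" "us \<in> coarsenings ws"
  shows "(\<Sum>vs | vs \<in> coarsenings ws \<and> us \<in> coarsenings vs. (-1) ^ length vs) =
    (if us = ws then (-1) ^ length ws else (0 :: 'k::comm_ring_1))"
  using assms
proof (induction ws arbitrary: us)
  case Nil
  then have "{vs. vs \<in> coarsenings [] \<and> us \<in> coarsenings vs} = {[]}" by auto
  then show ?case using Nil by simp
next
  case (Cons k ws)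
  have ne: "[] \<notin> set ws" using Cons.prems by auto
  note nonempty = coarsenings_nonempty_words[OF ne]
  let ?S = "\<lambda>us. {vs. vs \<in> coarsenings ws \<and> us \<in> coarsenings vs}"
  let ?T = "{vs. vs \<in> coarsenings (k # ws) \<and> us \<in> coarsenings vs}"
  consider us' where "us' \<in> coarsenings ws" "us = k # us'"
    | u us' where "u # us' \<in> coarsenings ws" "us = (k @ u) # us'"
    using Cons.prems(2) by (auto simp: coarsenings_Cons_iff)
  then show ?case
  proof cases
    case 1
    have "?T = Cons k ` ?S us'"
    proof (intro set_eqI)
      fix vs
      \<comment> \<open>Once merged, \<open>k\<close> cannot become a separate word again, so every
        intermediate list keeps \<open>k\<close> and only the tail varies.\<close>
      have "k # us' \<notin> coarsenings ((k @ x) # xs)" if "x # xs \<in> coarsenings ws" for x xs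
        using nonempty[OF that] by (intro Cons_notin_coarsenings_extended) auto
      moreover have "k # us' \<in> coarsenings (k # xs) \<longleftrightarrow> us' \<in> coarsenings xs"
        if "xs \<in> coarsenings ws" for xs
        using nonempty[OF that] by (rule Cons_mem_coarsenings_same)
      ultimately show "vs \<in> ?T \<longleftrightarrow> vs \<in> Cons k ` ?S us'"
        by (auto simp: 1(2) coarsenings_Cons_iff[of vs k ws])
    qed
    then show ?thesis
      using Cons.IH[OF ne 1(1)] 1
      by (simp add: sum.reindex sum_negf)
  next
    case 2
    let ?S' = "?S (u # us')"
    have u: "u \<noteq> []" using nonempty 2 by force
    have nil: "[] \<notin> ?S'" by auto
    \<comment> \<open>Both ways of treating \<open>k\<close> leave the same condition on the tail,
      so \<open>?T\<close> consists of two copies of \<open>?S'\<close>. \<open>Cons k\<close>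
      raises the length by one and \<open>merge_hd k\<close> preserves it, hence the signs are
      opposite.\<close>
    have T: "?T = Cons k ` ?S' \<union> merge_hd k ` ?S'"
    proof (intro set_eqI)
      fix vs
      have "vs \<in> ?T \<longleftrightarrow> (\<exists>xs \<in> coarsenings ws. vs = k # xs \<and> us \<in> coarsenings vs) \<or>
        (\<exists>x xs. x # xs \<in> coarsenings ws \<and> vs = (k @ x) # xs \<and> us \<in> coarsenings vs)"
        by (auto simp: coarsenings_Cons_iff[of vs k ws])
      also have "\<dots> \<longleftrightarrow> (\<exists>xs \<in> ?S'. vs = k # xs) \<or> (\<exists>x xs. x # xs \<in> ?S' \<and> vs = (k @ x) # xs)"
        using u by (auto simp: 2(2) append_mem_coarsenings append_mem_coarsenings_append)
      also have "\<dots> \<longleftrightarrow> vs \<in> Cons k ` ?S' \<union> merge_hd k ` ?S'"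
        using merge_hd_image_iff[of vs k ?S'] nil by (simp add: image_iff Bex_def)
      finally show "vs \<in> ?T \<longleftrightarrow> vs \<in> Cons k ` ?S' \<union> merge_hd k ` ?S'" .
    qed
    have disj: "Cons k ` ?S' \<inter> merge_hd k ` ?S' = {}"
    proof -
      \<comment> \<open>The words of \<open>ys\<close> are nonempty, so the first word of
        \<open>merge_hd k ys\<close> is longer than \<open>k\<close>.\<close>
      have "k # xs \<noteq> merge_hd k ys" if "ys \<in> ?S'" for xs ys
        using that nil nonempty by (cases ys) force+
      then show ?thesis by blast
    qed
    have inj: "inj_on (merge_hd k) ?S'"
    proof (rule inj_onI)
      fix x y assume "x \<in> ?S'" "y \<in> ?S'" "merge_hd k x = merge_hd k y"
      then show "x = y" using nil by (cases x; cases y) auto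
    qed
    have len: "length (merge_hd k vs) = length vs" if "vs \<in> ?S'" for vs
      using that nil by (cases vs) auto
    have "(\<Sum>vs\<in>?T. (-1 :: 'k) ^ length vs) =
        (\<Sum>vs\<in>?S'. (-1) ^ Suc (length vs)) + (\<Sum>vs\<in>?S'. (-1) ^ length vs)"
      unfolding T using disj inj len
      by (subst sum.union_disjoint) (auto simp: sum.reindex)
    also have "\<dots> = 0"
      by (simp add: sum_negf)
    \<comment> \<open>Here \<open>us\<close> differs from \<open>k # ws\<close>, since its first
      word properly extends \<open>k\<close>.\<close>
    finally show ?thesis using 2 u by auto
  qed
qed

section \<open>Refinement of sentences\<close>

lemma refines_iff_coarsenings: "J \<preceq>\<^sub>r I \<longleftrightarrow> words_of I \<in> coarsenings (words_of J)"
  by (simp add: refines_def coarsenings_iff_blocks nonempty_words)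

text \<open>Cutting the blocks \<open>L\<close> at the places prescribed by \<open>M\<close> gives
  groups \<open>N\<close> of blocks; flattening each group yields the blocks that cut
  \<open>K\<close> directly into the words of \<open>I\<close>.\<close>

lemma refines_trans:
  assumes "K \<preceq>\<^sub>r J" "J \<preceq>\<^sub>r I"
  shows "K \<preceq>\<^sub>r I"
proof -
  obtain L M where L: "concat L = words_of K" "map concat L = words_of J"
    and M: "concat M = map concat L" "map concat M = words_of I"
    using assms unfolding refines_def by metis
  have "\<exists>N. concat N = L \<and> map (map concat) N = M"
    using M(1)
  proof (induction M arbitrary: L)
    case (Cons m M)
    then obtain N where "concat N = drop (length m) L" "map (map concat) N = M"
      by (metis append_eq_conv_conj concat.simps(2) drop_map)
    moreover have "map concat (take (length m) L) = m"
      using Cons.prems by (metis append_eq_conv_conj concat.simps(2) take_map)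
    ultimately show ?case
      by (intro exI[of _ "take (length m) L # N"]) simp
  qed simp
  then obtain N where N: "concat N = L" "map (map concat) N = M" by blast
  have concat_concat: "concat (map concat Xs) = concat (concat Xs)" for Xs :: "'x list list list"
    by (induction Xs) auto
  have "concat (map concat N) = words_of K"
    using L(1) N(1) by (simp add: concat_concat)
  moreover have "map concat (map concat N) = words_of I"
    using M(2) N(2) by (auto simp: concat_concat comp_def)
  ultimately show ?thesis unfolding refines_def by blast
qed

lemma alternating_sum_refinement_interval:
  assumes "K \<preceq>\<^sub>r I"
  shows "(\<Sum>J | K \<preceq>\<^sub>r J \<and> J \<preceq>\<^sub>r I. (-1) ^ sent_length J) =
    (if K = I then (-1) ^ sent_length I else (0 :: 'k::comm_ring_1))"
proof -
  have "words_of ` {J. K \<preceq>\<^sub>r J \<and> J \<preceq>\<^sub>r I} =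
      {vs. vs \<in> coarsenings (words_of K) \<and> words_of I \<in> coarsenings vs}" (is "?L = ?R")
  proof
    show "?L \<subseteq> ?R" by (auto simp: refines_iff_coarsenings)
    show "?R \<subseteq> ?L"
    proof
      fix vs assume vs: "vs \<in> ?R"
      \<comment> \<open>Coarsening creates no empty word, so every intermediate list comes from a
        sentence.\<close>
      then have "words_of (Sentence vs) = vs"
        using coarsenings_nonempty_words[OF nonempty_words, of vs K]
        by (simp add: Sentence_inverse)
      then show "vs \<in> ?L"
        using vs by (intro image_eqI[of _ _ "Sentence vs"]) (auto simp: refines_iff_coarsenings)
    qed
  qed
  then have "(\<Sum>J | K \<preceq>\<^sub>r J \<and> J \<preceq>\<^sub>r I. (-1 :: 'k) ^ sent_length J) =
      (\<Sum>vs | vs \<in> coarsenings (words_of K) \<and> words_of I \<in> coarsenings vs. (-1) ^ length vs)"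
    by (intro sum.reindex_cong[of words_of, THEN sym])
       (auto simp: sent_length_def inj_on_def words_of_inject)
  also have "\<dots> = (if K = I then (-1) ^ sent_length I else 0)"
    using alternating_sum_coarsenings[OF nonempty_words, of "words_of I" K] assms
    by (auto simp: refines_iff_coarsenings words_of_inject sent_length_def)
  finally show ?thesis .
qed

section \<open>Inversion\<close>

lemma minus_one_power_diff:
  "m \<le> n \<Longrightarrow> (-1) ^ (n - m) = (-1 :: 'k::comm_ring_1) ^ n * (-1) ^ m"
  by (simp flip: power_add) (metis even_add le_add_diff_inverse minus_one_power_iff)

lemma H_eq_sum_E:
  "H I = (\<Sum>J | J \<preceq>\<^sub>r I.
     nsym_scale ((-1) ^ (sent_size I - sent_length J)) (E J :: 'a sentence \<Rightarrow>\<^sub>0 'k::field))"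
proof -
  \<comment> \<open>Refinement preserves size, so the sign of the size occurs twice and
    cancels.\<close>
  have sign: "(-1 :: 'k) ^ (sent_size I - sent_length J) * (-1) ^ (sent_size J - sent_length K) =
      (-1) ^ sent_length K * (-1) ^ sent_length J" if "J \<preceq>\<^sub>r I" "K \<preceq>\<^sub>r J" for J K
  proof -
    have "sent_size J = sent_size I" using refines_size that by blast
    then have "sent_length J \<le> sent_size I" "sent_length K \<le> sent_size I"
      using refines_length_le that by metis+
    then show ?thesis
      using \<open>sent_size J = sent_size I\<close> by (simp add: minus_one_power_diff mult_ac)
  qed
  have "(\<Sum>J | J \<preceq>\<^sub>r I. nsym_scale ((-1) ^ (sent_size I - sent_length J)) (E J)) =
      (\<Sum>J | J \<preceq>\<^sub>r I. \<Sum>K | K \<preceq>\<^sub>r J.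
        nsym_scale ((-1) ^ sent_length K * (-1) ^ sent_length J) (H K :: 'a sentence \<Rightarrow>\<^sub>0 'k))"
    unfolding E_def nsym.scale_sum_right by (intro sum.cong) (auto simp: sign)
  \<comment> \<open>Adding \<open>K \<preceq>\<^sub>r I\<close>, which holds by transitivity, makes
    both indices range over one fixed finite set, as the exchange of sums requires.\<close>
  also have "\<dots> = (\<Sum>J | J \<preceq>\<^sub>r I. \<Sum>K | K \<preceq>\<^sub>r I \<and> K \<preceq>\<^sub>r J.
        nsym_scale ((-1) ^ sent_length K * (-1) ^ sent_length J) (H K))"
    by (intro sum.cong refl) (auto intro: refines_trans)
  also have "\<dots> = (\<Sum>K | K \<preceq>\<^sub>r I. \<Sum>J | J \<preceq>\<^sub>r I \<and> K \<preceq>\<^sub>r J.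
        nsym_scale ((-1) ^ sent_length K * (-1) ^ sent_length J) (H K))"
    using sum.swap_restrict[OF finite_refinements finite_refinements,
        where R = "\<lambda>J K. K \<preceq>\<^sub>r J"] by simp
  also have "\<dots> = (\<Sum>K | K \<preceq>\<^sub>r I. nsym_scale ((-1) ^ sent_length K *
        (\<Sum>J | K \<preceq>\<^sub>r J \<and> J \<preceq>\<^sub>r I. (-1) ^ sent_length J)) (H K))"
    by (simp add: sum_distrib_left nsym.scale_sum_left conj_commute)
  also have "\<dots> = (\<Sum>K | K \<preceq>\<^sub>r I. if K = I then H K else 0)"
    by (intro sum.cong refl)
      (auto simp: alternating_sum_refinement_interval simp flip: power_add)
  also have "\<dots> = H I"
    by (simp add: finite_refinements) (simp add: refines_iff_coarsenings refl_coarsenings)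
  finally show ?thesis by simp
qed

section \<open>Transport of the basis \<open>H\<close> to \<open>E\<close>\<close>

theorem E_basis:
  "is_basis_family (sentences A) E (NSym A :: ('a sentence \<Rightarrow>\<^sub>0 'k::field) set)"
proof -
  interpret pair: vector_space_pair
    "nsym_scale :: 'k \<Rightarrow> ('a sentence \<Rightarrow>\<^sub>0 'k) \<Rightarrow> _" "nsym_scale :: 'k \<Rightarrow> ('a sentence \<Rightarrow>\<^sub>0 'k) \<Rightarrow> _"
    by unfold_locales
  let ?H = "H :: 'a sentence \<Rightarrow> 'a sentence \<Rightarrow>\<^sub>0 'k"
  let ?E = "E :: 'a sentence \<Rightarrow> 'a sentence \<Rightarrow>\<^sub>0 'k"
  \<comment> \<open>Over the full alphabet \<open>H\<close> spans the whole type, so a linear map is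
    determined everywhere by its values on \<open>H\<close>.\<close>
  have univ: "sentences UNIV = (UNIV :: 'a sentence set)" "NSym UNIV = (UNIV :: ('a sentence \<Rightarrow>\<^sub>0 'k) set)"
    by (auto simp: sentences_def NSym_def)
  have inj_H: "inj ?H" and indep_H: "nsym.independent (range ?H)" and span_H: "nsym.span (range ?H) = UNIV"
    using H_basis[of "UNIV :: 'a set", where 'k = 'k] by (simp_all add: is_basis_family_def univ)
  define g where "g = pair.construct (range ?H) (?E \<circ> inv ?H)"
  have g: "Vector_Spaces.linear nsym_scale nsym_scale g"
    unfolding g_def by (rule pair.linear_construct[OF indep_H])
  have gH: "g (?H I) = ?E I" for I
    by (simp add: g_def pair.construct_basis[OF indep_H] inj_H)
  interpret g: Vector_Spaces.linear nsym_scale nsym_scale g by (fact g)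
  \<comment> \<open>Applying \<open>g\<close> to the definition of \<open>E I\<close> replaces each
    \<open>H J\<close> by \<open>E J\<close>, which is the inversion formula for
    \<open>H I\<close>.\<close>
  have gE: "g (?E I) = ?H I" for I
    unfolding H_eq_sum_E[of I] by (subst E_def) (simp add: g.sum g.scale gH)
  have gg: "Vector_Spaces.linear nsym_scale nsym_scale (g \<circ> g)"
    by (rule Vector_Spaces.linear_compose[OF g g])
  have "(g \<circ> g) f = id f" for f
    by (rule pair.linear_eq_on[OF gg nsym.linear_id, where B = "range ?H"])
       (auto simp: gH gE span_H)
  then have inj_g: "inj g"
    by (metis comp_apply id_apply injI)
  have image: "?E ` S = g ` ?H ` S" for S
    by (auto simp: gH image_image)
  have "inj ?E"
    using inj_compose[OF inj_g inj_H] by (simp add: comp_def gH)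
  moreover have "nsym.independent (?E ` sentences A)"
    unfolding image
    using nsym.independent_mono[OF indep_H image_mono[OF subset_UNIV]] inj_on_subset[OF inj_g]
    by (intro pair.linear_independent_injective_image[OF g]) auto
  moreover have "nsym.span (?E ` sentences A) = NSym A"
  proof
    \<comment> \<open>Refinement preserves letters, so the expansions of \<open>E\<close> in
      \<open>H\<close> and of \<open>H\<close> in \<open>E\<close> both stay over \<open>A\<close>;
      this gives the two inclusions of spans.\<close>
    have sent: "J \<in> sentences A" if "J \<preceq>\<^sub>r I" "I \<in> sentences A" for I J
      using that by (simp add: sentences_def refines_letters)
    have span_H_A: "nsym.span (?H ` sentences A) = NSym A"
      using H_basis[of A, where 'k = 'k] by (simp add: is_basis_family_def)
    have E_in: "?E I \<in> nsym.span (?H ` sentences A)" if "I \<in> sentences A" for I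
      unfolding E_def
      using that sent by (blast intro: nsym.span_sum nsym.span_scale nsym.span_base)
    have H_in: "?H I \<in> nsym.span (?E ` sentences A)" if "I \<in> sentences A" for I
      unfolding H_eq_sum_E[of I]
      using that sent by (blast intro: nsym.span_sum nsym.span_scale nsym.span_base)
    show "nsym.span (?E ` sentences A) \<subseteq> NSym A"
      unfolding span_H_A[symmetric] using E_in
      by (intro nsym.span_minimal nsym.subspace_span image_subsetI)
    show "NSym A \<subseteq> nsym.span (?E ` sentences A)"
      unfolding span_H_A[symmetric] using H_in
      by (intro nsym.span_minimal nsym.subspace_span image_subsetI)
  qed
  ultimately show ?thesis
    by (auto simp: is_basis_family_def intro: inj_on_subset)
qed

theorem proposition3p9:
  fixes A :: "'a set"
  assumes "finite A"
  shows "is_basis_family (sentences A) E (NSym A :: ('a sentence \<Rightarrow>\<^sub>0 'k::field_char_0) set)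
    \<and> (\<forall>I \<in> sentences A.
         (H I :: 'a sentence \<Rightarrow>\<^sub>0 'k) =
           (\<Sum>J | J \<preceq>\<^sub>r I. nsym_scale ((-1) ^ (sent_size I - sent_length J)) (E J)))"
  using E_basis H_eq_sum_E by blast

end
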